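(* Let $p$ be a positive real number, $n$ a positive integer, and $\mu\in W^{n-1,\infty}(\mathbb{D},\mathbb{B})$ such that $\|\mu\|_{W^{n-1,\infty}(\mathbb{D},\mathbb{B})}\le c<1$ for some positive real number $c$. Let $w=\sum_{k=0}^{n-1}\widehat{(z^* )}^{\,k}w_k$, where each $w_k:\mathbb{D}\to\mathbb{B}$ solves $\bar\partial w_k=\mu\,\partial w_k$. Then $w\in H^{n,p}_{Bel,\mu}(\mathbb{D},\mathbb{B})$ if and only if $w_k\in H^p_{Bel,\mu}(\mathbb{D},\mathbb{B})$ for $0\le k\le n-1$.
   Context: $\mathbb{D}$ is the unit disk in $\mathbb{C}$, $z=x+iy$, $z^*=x-iy$. The bicomplex numbers $\mathbb{B}=\{z_1+jz_2: z_1,z_2\in\mathbb{C}\}$ form the commutative $\mathbb{C}$-algebra with $j^2=-1$, $ij=ji$. Put $p^\pm=\frac12(1\pm ji)$. Every $w=z_1+jz_2\in\mathbb{B}$ is uniquely $w=p^+w^++p^-w^-$ with $w^\pm=z_1\mp iz_2\in\mathbb{C}$. Norm: $\|w\|_{\mathbb{B}}=\sqrt{(|w^+|^2+|w^-|^2)/2}$. For $x,y\in\mathbb{R}$ the bicomplexification of $x+iy$ is $\widehat{x+iy}=x+jy$; thus $\widehat{z^*}=x-jy$. $W^{k,\infty}(\mathbb{D},\mathbb{B})$ is the class of $f:\mathbb{D}\to\mathbb{B}$ such that $f$ and its derivatives up to order $k$ are in $L^\infty(\mathbb{D},\mathbb{B})$ (bounded with respect to $\|\cdot\|_{\mathbb{B}}$).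 The bicomplex operators are $\partial=\frac12(\partial_x-j\partial_y)$ and $\bar\partial=\frac12(\partial_x+j\partial_y)$. $H^p_{Bel,\mu}(\mathbb{D},\mathbb{B})$ is the set of $v:\mathbb{D}\to\mathbb{B}$ that solve $\bar\partial v=\mu\,\partial v$ and satisfy $\left(\sup_{0<r<1}\frac1{2\pi}\int_0^{2\pi}\|v(re^{i\theta})\|_{\mathbb{B}}^p\,d\theta\right)^{1/p}<\infty$. $H^{n,p}_{Bel,\mu}(\mathbb{D},\mathbb{B})$ is the set of $w:\mathbb{D}\to\mathbb{B}$ that solve $(\bar\partial-\mu\partial)^nw=0$ (the power denoting iteration) and satisfy $$\sum_{k=0}^{n-1}\sup_{0<r<1}\int_0^{2\pi}\left\|(\bar\partial-\mu\partial)^kw(re^{i\theta})\right\|_{\mathbb{B}}^p\,d\theta<\infty.$$ Solutions of the $n$-th order equation are representable in the form $\sum_{k=0}^{n-1}\widehat{(z^* )}^{\,k}w_k$ with $w_k$ as in the claim; this is the representation meant. *)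

theory Defs
  imports "HOL-Analysis.Analysis" "HOL-Probability.Essential_Supremum"
begin

section \<open>Bicomplex numbers\<close>

text \<open>\<open>Bicomplex z1 z2\<close> is $z_1 + j z_2$.\<close>

datatype bicomplex = Bicomplex (bc1: complex) (bc2: complex)

lemma bicomplex_eq_iff: "v = w \<longleftrightarrow> bc1 v = bc1 w \<and> bc2 v = bc2 w"
  by (cases v; cases w) simp

instantiation bicomplex :: comm_ring_1
begin

definition "0 = Bicomplex 0 0"
definition "1 = Bicomplex 1 0"
definition "v + w = Bicomplex (bc1 v + bc1 w) (bc2 v + bc2 w)"
definition "- w = Bicomplex (- bc1 w) (- bc2 w)"
definition "v - w = Bicomplex (bc1 v - bc1 w) (bc2 v - bc2 w)"
definition "v * w = Bicomplex (bc1 v * bc1 w - bc2 v * bc2 w) (bc1 v * bc2 w + bc2 v * bc1 w)"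

instance
  by standard
    (simp_all add: bicomplex_eq_iff zero_bicomplex_def one_bicomplex_def plus_bicomplex_def
      uminus_bicomplex_def minus_bicomplex_def times_bicomplex_def algebra_simps)

end

lemma bicomplex_sel [simp]:
  "bc1 0 = 0" "bc2 0 = 0" "bc1 1 = 1" "bc2 1 = 0"
  "bc1 (v + w) = bc1 v + bc1 w" "bc2 (v + w) = bc2 v + bc2 w"
  "bc1 (- w) = - bc1 w" "bc2 (- w) = - bc2 w"
  "bc1 (v - w) = bc1 v - bc1 w" "bc2 (v - w) = bc2 v - bc2 w"
  "bc1 (v * w) = bc1 v * bc1 w - bc2 v * bc2 w"
  "bc2 (v * w) = bc1 v * bc2 w + bc2 v * bc1 w"
  by (simp_all add: zero_bicomplex_def one_bicomplex_def plus_bicomplex_def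
      uminus_bicomplex_def minus_bicomplex_def times_bicomplex_def)

definition bc_i :: bicomplex where "bc_i = Bicomplex \<i> 0"

definition bc_j :: bicomplex where "bc_j = Bicomplex 0 1"

lemma bc_j_squared: "bc_j * bc_j = - 1"
  by (simp add: bicomplex_eq_iff bc_j_def)

definition bc_plus :: "bicomplex \<Rightarrow> complex" where "bc_plus w = bc1 w - \<i> * bc2 w"

definition bc_minus :: "bicomplex \<Rightarrow> complex" where "bc_minus w = bc1 w + \<i> * bc2 w"

instantiation bicomplex :: real_algebra_1
begin

definition "scaleR r w = Bicomplex (r *\<^sub>R bc1 w) (r *\<^sub>R bc2 w)"

instance
  by standard (simp_all add: bicomplex_eq_iff scaleR_bicomplex_def algebra_simps)

end

lemma bicomplex_scaleR_sel [simp]: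
  "bc1 (r *\<^sub>R w) = r *\<^sub>R bc1 w" "bc2 (r *\<^sub>R w) = r *\<^sub>R bc2 w"
  by (simp_all add: scaleR_bicomplex_def)

definition bc_p_plus :: bicomplex where "bc_p_plus = (1/2) *\<^sub>R (1 + bc_j * bc_i)"

definition bc_p_minus :: bicomplex where "bc_p_minus = (1/2) *\<^sub>R (1 - bc_j * bc_i)"

lemma bicomplex_idempotent_decomposition:
  "w = bc_p_plus * Bicomplex (bc_plus w) 0 + bc_p_minus * Bicomplex (bc_minus w) 0"
  by (simp add: bicomplex_eq_iff bc_p_plus_def bc_p_minus_def bc_i_def bc_j_def bc_plus_def
      bc_minus_def complex_eq_iff field_simps)

instantiation bicomplex :: real_inner
begin

definition inner_bicomplex_def: "inner v w = inner (bc1 v) (bc1 w) + inner (bc2 v) (bc2 w)"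

definition norm_bicomplex_def:
  "norm w = sqrt (((cmod (bc_plus w))\<^sup>2 + (cmod (bc_minus w))\<^sup>2) / 2)"

definition sgn_bicomplex_def: "sgn (w::bicomplex) = w /\<^sub>R norm w"

definition dist_bicomplex_def: "dist v w = norm (v - w :: bicomplex)"

definition uniformity_bicomplex_def [code del]:
  "(uniformity :: (bicomplex \<times> bicomplex) filter)
     = (INF e\<in>{0 <..}. principal {(x, y). dist x y < e})"

definition open_bicomplex_def [code del]:
  "open (U :: bicomplex set)
     \<longleftrightarrow> (\<forall>x\<in>U. eventually (\<lambda>(x', y). x' = x \<longrightarrow> y \<in> U) uniformity)"

instance
proof
  fix u v w :: bicomplex and r :: real
  show "inner v w = inner w v"
    by (simp add: inner_bicomplex_def inner_commute)
  show "inner (u + v) w = inner u w + inner v w"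
    by (simp add: inner_bicomplex_def inner_add_left)
  show "inner (r *\<^sub>R v) w = r * inner v w"
    by (simp add: inner_bicomplex_def distrib_left)
  show "0 \<le> inner w w"
    by (simp add: inner_bicomplex_def)
  show "inner w w = 0 \<longleftrightarrow> w = 0"
    by (simp add: inner_bicomplex_def bicomplex_eq_iff add_nonneg_eq_0_iff)
  show "norm w = sqrt (inner w w)"
    unfolding norm_bicomplex_def inner_bicomplex_def bc_plus_def bc_minus_def cmod_power2
      inner_complex_def
    by (simp add: power2_eq_square algebra_simps)
qed (rule sgn_bicomplex_def dist_bicomplex_def open_bicomplex_def uniformity_bicomplex_def)+

end

instantiation bicomplex :: euclidean_space
begin

definition Basis_bicomplex_def:
  "Basis = (\<lambda>b. Bicomplex b 0) ` Basis \<union> (\<lambda>b. Bicomplex 0 b) ` Basis"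

instance
  by standard
    (auto simp: Basis_bicomplex_def inner_bicomplex_def bicomplex_eq_iff inner_Basis
      ball_Un euclidean_all_zero_iff simp del: Basis_complex_def split: if_splits)

end

text \<open>The bicomplexification $\widehat{x+iy} = x + jy$.\<close>

definition bc_hat :: "complex \<Rightarrow> bicomplex" where
  "bc_hat z = Bicomplex (of_real (Re z)) (of_real (Im z))"


section \<open>Weak derivatives on the unit disk\<close>

text \<open>Functions on the disk are total functions on \<^typ>\<open>complex\<close> of which only the values on
  the disk matter; functions that agree almost everywhere there are identified, as is usual for
  Sobolev functions.\<close>

abbreviation unit_disk :: "complex set" where "unit_disk \<equiv> ball 0 1"

definition locally_integrable :: "(complex \<Rightarrow> bicomplex) \<Rightarrow> bool" where
  "locally_integrable f \<longleftrightarrow> (\<forall>K. compact K \<and> K \<subseteq> unit_disk \<longrightarrow> f absolutely_integrable_on K)"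

text \<open>Real test functions of class $C^1_c$ are the usual choice for first-order weak derivatives
  (as in Gilbarg--Trudinger); by mollification $C^\infty_c$ gives the same notion.\<close>

definition test_function :: "(complex \<Rightarrow> real) \<Rightarrow> bool" where
  "test_function \<phi> \<longleftrightarrow>
     closure {z. \<phi> z \<noteq> 0} \<subseteq> unit_disk \<and>
     (\<forall>z. \<phi> differentiable (at z)) \<and>
     (\<forall>e. continuous_on UNIV (\<lambda>z. frechet_derivative \<phi> (at z) e))"

text \<open>\<open>g\<close> is the weak derivative of \<open>f\<close> in the direction \<open>e\<close>; the direction \<open>1\<close> gives
  $\partial_x$ and \<open>\<i>\<close> gives $\partial_y$.\<close>

definition has_weak_partial ::
    "complex \<Rightarrow> (complex \<Rightarrow> bicomplex) \<Rightarrow> (complex \<Rightarrow> bicomplex) \<Rightarrow> bool" where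
  "has_weak_partial e f g \<longleftrightarrow>
     locally_integrable f \<and> locally_integrable g \<and>
     (\<forall>\<phi>. test_function \<phi> \<longrightarrow>
        (LINT z:unit_disk|lebesgue. frechet_derivative \<phi> (at z) e *\<^sub>R f z)
          = - (LINT z:unit_disk|lebesgue. \<phi> z *\<^sub>R g z))"

definition weakly_differentiable :: "(complex \<Rightarrow> bicomplex) \<Rightarrow> bool" where
  "weakly_differentiable f \<longleftrightarrow>
     (\<exists>g. has_weak_partial 1 f g) \<and> (\<exists>g. has_weak_partial \<i> f g)"

text \<open>Weak derivatives are determined up to a null set; one of them is chosen.\<close>

definition weak_partial :: "complex \<Rightarrow> (complex \<Rightarrow> bicomplex) \<Rightarrow> (complex \<Rightarrow> bicomplex)" where
  "weak_partial e f = (SOME g. has_weak_partial e f g)"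

definition weak_deriv_xy :: "nat \<Rightarrow> nat \<Rightarrow> (complex \<Rightarrow> bicomplex) \<Rightarrow> (complex \<Rightarrow> bicomplex)" where
  "weak_deriv_xy a b f = (weak_partial 1 ^^ a) ((weak_partial \<i> ^^ b) f)"

definition Linf_norm :: "(complex \<Rightarrow> bicomplex) \<Rightarrow> ennreal" where
  "Linf_norm f = esssup (lebesgue_on unit_disk) (\<lambda>z. ennreal (norm (f z)))"

definition Linf :: "(complex \<Rightarrow> bicomplex) set" where
  "Linf = {f. f \<in> borel_measurable (lebesgue_on unit_disk) \<and> Linf_norm f < \<infinity>}"

definition Wkinf :: "nat \<Rightarrow> (complex \<Rightarrow> bicomplex) set" where
  "Wkinf k = {f. (\<forall>a b. a + b < k \<longrightarrow> weakly_differentiable (weak_deriv_xy a b f)) \<and>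
                 (\<forall>a b. a + b \<le> k \<longrightarrow> weak_deriv_xy a b f \<in> Linf)}"

text \<open>The maximum over all derivatives is the smallest of the customary norms, so that a bound on
  it is implied by a bound on, for instance, the sum.\<close>

definition Wkinf_norm :: "nat \<Rightarrow> (complex \<Rightarrow> bicomplex) \<Rightarrow> ennreal" where
  "Wkinf_norm k f = (SUP (a, b) \<in> {(a, b). a + b \<le> k}. Linf_norm (weak_deriv_xy a b f))"


section \<open>The Beltrami equation\<close>

definition bc_del :: "(complex \<Rightarrow> bicomplex) \<Rightarrow> (complex \<Rightarrow> bicomplex)" where
  "bc_del f z = (1/2) *\<^sub>R (weak_partial 1 f z - bc_j * weak_partial \<i> f z)"

definition bc_delbar :: "(complex \<Rightarrow> bicomplex) \<Rightarrow> (complex \<Rightarrow> bicomplex)" where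
  "bc_delbar f z = (1/2) *\<^sub>R (weak_partial 1 f z + bc_j * weak_partial \<i> f z)"

text \<open>$\bar\partial - \mu\partial$\<close>

definition beltrami_op ::
    "(complex \<Rightarrow> bicomplex) \<Rightarrow> (complex \<Rightarrow> bicomplex) \<Rightarrow> (complex \<Rightarrow> bicomplex)" where
  "beltrami_op \<mu> f z = bc_delbar f z - \<mu> z * bc_del f z"

definition solves_beltrami :: "(complex \<Rightarrow> bicomplex) \<Rightarrow> (complex \<Rightarrow> bicomplex) \<Rightarrow> bool" where
  "solves_beltrami \<mu> v \<longleftrightarrow>
     weakly_differentiable v \<and>
     (AE z in lebesgue. z \<in> unit_disk \<longrightarrow> bc_delbar v z = \<mu> z * bc_del v z)"

definition solves_beltrami_iterated ::
    "nat \<Rightarrow> (complex \<Rightarrow> bicomplex) \<Rightarrow> (complex \<Rightarrow> bicomplex) \<Rightarrow> bool" where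
  "solves_beltrami_iterated n \<mu> w \<longleftrightarrow>
     (\<forall>k<n. weakly_differentiable ((beltrami_op \<mu> ^^ k) w)) \<and>
     (AE z in lebesgue. z \<in> unit_disk \<longrightarrow> (beltrami_op \<mu> ^^ n) w z = 0)"


section \<open>Hardy classes\<close>

definition circle_integral :: "real \<Rightarrow> (complex \<Rightarrow> bicomplex) \<Rightarrow> real \<Rightarrow> ennreal" where
  "circle_integral p u r =
     (\<integral>\<^sup>+ \<theta>\<in>{0..2*pi}. ennreal (norm (u (of_real r * cis \<theta>)) powr p) \<partial>lborel)"

text \<open>A circle is a null set, so the supremum over all radii is meaningful for a function given up
  to null sets only after a representative has been fixed; the infimum over all representatives
  below removes this choice. It is attained, and equals the essential supremum over the radius of
  the circle integrals of any Borel representative. For continuous \<open>v\<close> it is the supremum of the circle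
  integrals of \<open>v\<close> itself, since these depend on the radius in a continuous way; for weakly
  differentiable \<open>v\<close> it is the supremum of the integrals of the traces of \<open>v\<close> on the circles.\<close>

definition representatives :: "(complex \<Rightarrow> bicomplex) \<Rightarrow> (complex \<Rightarrow> bicomplex) set" where
  "representatives v =
     {u. u \<in> borel_measurable borel \<and> (AE z in lebesgue. z \<in> unit_disk \<longrightarrow> u z = v z)}"

definition circle_sup :: "real \<Rightarrow> (complex \<Rightarrow> bicomplex) \<Rightarrow> ennreal" where
  "circle_sup p v = (INF u\<in>representatives v. SUP r\<in>{0<..<1}. circle_integral p u r)"

definition ennreal_root :: "real \<Rightarrow> ennreal \<Rightarrow> ennreal" where
  "ennreal_root p x = (if x = \<infinity> then \<infinity> else ennreal (enn2real x powr (1 / p)))"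

definition hardy_norm :: "real \<Rightarrow> (complex \<Rightarrow> bicomplex) \<Rightarrow> ennreal" where
  "hardy_norm p v =
     (INF u\<in>representatives v.
        ennreal_root p (SUP r\<in>{0<..<1}. ennreal (1 / (2 * pi)) * circle_integral p u r))"

definition H_Bel :: "real \<Rightarrow> (complex \<Rightarrow> bicomplex) \<Rightarrow> (complex \<Rightarrow> bicomplex) set" where
  "H_Bel p \<mu> = {v. solves_beltrami \<mu> v \<and> hardy_norm p v < \<infinity>}"

definition H_Bel_n :: "nat \<Rightarrow> real \<Rightarrow> (complex \<Rightarrow> bicomplex) \<Rightarrow> (complex \<Rightarrow> bicomplex) set" where
  "H_Bel_n n p \<mu> =
     {w. solves_beltrami_iterated n \<mu> w \<and>
         (\<Sum>k<n. circle_sup p ((beltrami_op \<mu> ^^ k) w)) < \<infinity>}"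

end

(*  The operator L = dbar - mu d is a derivation with L zeta = 1 for zeta = bc_hat (cnj z), and it
    annihilates every w_k.  Hence L^m w is the sum of k (k-1) ... (k-m+1) zeta^(k-m) w_k over k, a
    triangular system in w_0, ..., w_(n-1) with the nonzero diagonal entries m!.  As zeta is bounded
    on the disk, finiteness of the Hardy norms passes from the w_k to the L^m w, and by descending
    induction on m back from the L^m w to the w_m.  Because derivatives are weak, this needs the
    uniqueness of weak derivatives, that is, the fundamental lemma of the calculus of variations. *)

theory Submission
  imports Defs "HOL-Real_Asymp.Real_Asymp"
begin

subsection \<open>The fundamental lemma of the calculus of variations\<close>

text \<open>\<open>weak_partial\<close> picks a derivative by \<open>SOME\<close>, so an iterate of
  \<open>beltrami_op\<close> is determined only up to a null set, and every formula for it is an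
  almost-everywhere statement. Two facts let the iteration proceed from such a formula: functions
  that agree a.e. have the same weak derivatives, and any weak derivative found by calculation is
  a.e. the chosen one. The product rule is required only for the factor
  \<open>bc_hat (cnj z)\<close>. Its components are real linear functions of \<open>z\<close>, so
  the factor can be moved onto the test function. Since \<open>p\<close> may be less than 1, the
  Hardy conditions are treated purely as finiteness conditions, with constants that depend on
  \<open>p\<close>.\<close>

lemma sigma_finite_lebesgue: "sigma_finite_measure (lebesgue :: 'a::euclidean_space measure)"
proof
  obtain A :: "'a set set" where A: "countable A" "A \<subseteq> sets lborel" "\<Union>A = space lborel"
      "\<forall>a\<in>A. emeasure lborel a \<noteq> \<infinity>"
    using lborel.sigma_finite_countable by blast
  then show "\<exists>A. countable A \<and> A \<subseteq> sets lebesgue \<and> \<Union>A = space lebesgue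
      \<and> (\<forall>a\<in>A. emeasure (lebesgue :: 'a measure) a \<noteq> \<infinity>)"
    by (intro exI[of _ A]) (auto simp: emeasure_completion)
qed

text \<open>Open boxes form an intersection-stable generator of the Borel sets, and the sets over
  which \<open>h\<close> integrates to 0 form a Dynkin system. So all Borel integrals vanish, then
  all Lebesgue ones, and \<open>density_zero\<close> applies.\<close>

lemma AE_zero_if_box_integrals_zero:
  fixes h :: "'a::euclidean_space \<Rightarrow> 'b::{second_countable_topology, banach}"
  assumes h: "integrable lebesgue h"
    and box: "\<And>a b. (LINT x:box a b|lebesgue. h x) = 0"
  shows "AE x in lebesgue. h x = 0"
proof (rule sigma_finite_measure.density_zero[OF sigma_finite_lebesgue h])
  let ?G = "range (\<lambda>(a, b). box a b :: 'a set)"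
  have int: "set_integrable lebesgue A h" if "A \<in> sets lebesgue" for A
    using integrable_mult_indicator[OF that h] by (simp add: set_integrable_def)
  \<comment> \<open>The complement case of the Dynkin argument relies on this; the space is
    exhausted by the increasing boxes \<open>?B n\<close>.\<close>
  have whole: "(LINT x:UNIV|lebesgue. h x) = 0"
  proof -
    let ?B = "\<lambda>n::nat. box (- (real n *\<^sub>R One)) (real n *\<^sub>R One) :: 'a set"
    have "(\<lambda>n. LINT x:?B n|lebesgue. h x) \<longlonglongrightarrow> (LINT x:(\<Union>n. ?B n)|lebesgue. h x)"
      by (rule set_integral_cont_up) (auto intro!: int incseq_SucI subset_box_imp simp: UN_box_eq_UNIV)
    then show ?thesis
      by (simp add: box UN_box_eq_UNIV LIMSEQ_const_iff)
  qed
  have borel: "(LINT x:A|lebesgue. h x) = 0" if "A \<in> sets borel" for A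
  proof -
    have sub: "sets borel = sigma_sets UNIV ?G"
      by (subst borel_eq_box) (simp add: sets_measure_of)
    have leb: "A \<in> sets lebesgue" if "A \<in> sigma_sets UNIV ?G" for A
      using that sub by auto
    have "Int_stable ?G"
      by (auto simp: Int_stable_def box_Int_box)
    moreover have "?G \<subseteq> Pow UNIV"
      by simp
    moreover have "A \<in> sigma_sets UNIV ?G"
      using that sub by simp
    ultimately show ?thesis
    proof (induction A rule: sigma_sets_induct_disjoint)
      case (compl A)
      have "(LINT x:UNIV - A|lebesgue. h x) + (LINT x:A|lebesgue. h x)
          = (LINT x:(UNIV - A) \<union> A|lebesgue. h x)"
        by (intro set_integral_Un[symmetric] int) (use leb[OF compl(1)] in auto)
      with compl whole show ?case by simp
    next
      case (union A)
      have A: "A i \<in> sets lebesgue" for i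
        using union(2) leb by blast
      have "(LINT x:(\<Union>i. A i)|lebesgue. h x) = (\<Sum>i. LINT x:A i|lebesgue. h x)"
        using union(1) A
        by (intro lebesgue_integral_countable_add int) (auto simp: disjoint_family_on_def)
      with union show ?case by simp
    qed (use box in \<open>auto simp: set_lebesgue_integral_def\<close>)
  qed
  fix A :: "'a set" assume A: "A \<in> sets lebesgue"
  \<comment> \<open>A Lebesgue set differs from its Borel part \<open>main_part lborel A\<close>
    only by a null set.\<close>
  have "AE x in lebesgue. x \<in> A \<longleftrightarrow> x \<in> main_part lborel A"
  proof -
    have "null_part lborel A \<in> null_sets lebesgue"
      using null_part_null_sets[OF A] by (simp add: null_sets_completion_iff2)
    from AE_not_in[OF this] show ?thesis
      by eventually_elim (use main_part_null_part_Un[OF A] in blast)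
  qed
  then have "(LINT x:A|lebesgue. h x) = (LINT x:main_part lborel A|lebesgue. h x)"
    using A main_part_sets[OF A] borel_measurable_integrable[OF h]
    by (intro set_integral_cong_set)
       (auto simp: set_borel_measurable_def intro!: borel_measurable_scaleR borel_measurable_indicator)
  also have "\<dots> = 0"
    using borel main_part_sets[OF A] by simp
  finally show "(LINT x:A|lebesgue. h x) = 0" .
qed

section \<open>C^1 functions and explicit bumps on boxes\<close>

text \<open>The derivative is an existential witness \<open>D\<close> rather than
  \<open>frechet_derivative\<close>, so that product and chain rules can supply it directly. The
  support condition of test functions is kept separate.\<close>

definition cont_diff :: "('a::real_normed_vector \<Rightarrow> real) \<Rightarrow> bool" where
  "cont_diff \<phi> \<longleftrightarrow> (\<exists>D. (\<forall>z. (\<phi> has_derivative D z) (at z)) \<and> (\<forall>e. continuous_on UNIV (\<lambda>z. D z e)))"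

lemma cont_diff_continuous: "cont_diff \<phi> \<Longrightarrow> continuous_on UNIV \<phi>"
  by (meson cont_diff_def differentiable_imp_continuous_on differentiable_on_def
      differentiable_at_withinI differentiable_def)

lemma cont_diff_frechet:
  assumes "cont_diff \<phi>"
  shows "\<phi> differentiable (at z)" "continuous_on UNIV (\<lambda>z. frechet_derivative \<phi> (at z) e)"
proof -
  obtain D where D: "\<And>z. (\<phi> has_derivative D z) (at z)" "\<And>e. continuous_on UNIV (\<lambda>z. D z e)"
    using assms by (auto simp: cont_diff_def)
  then show "\<phi> differentiable (at z)" by (auto simp: differentiable_def)
  have "frechet_derivative \<phi> (at z) = D z" for z
    using frechet_derivative_at[OF D(1)] by simp
  with D(2) show "continuous_on UNIV (\<lambda>z. frechet_derivative \<phi> (at z) e)" by simp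
qed

lemma cont_diff_mult:
  assumes "cont_diff f" "cont_diff g"
  shows "cont_diff (\<lambda>z. f z * g z)"
proof -
  obtain D where D: "\<And>z. (f has_derivative D z) (at z)" "\<And>e. continuous_on UNIV (\<lambda>z. D z e)"
    using assms by (auto simp: cont_diff_def)
  obtain E where E: "\<And>z. (g has_derivative E z) (at z)" "\<And>e. continuous_on UNIV (\<lambda>z. E z e)"
    using assms by (auto simp: cont_diff_def)
  show ?thesis
    unfolding cont_diff_def
    by (intro exI[of _ "\<lambda>z e. f z * E z e + D z e * g z"] conjI allI has_derivative_mult D E
        continuous_intros assms[THEN cont_diff_continuous])
qed

lemma cont_diff_bounded_linear:
  assumes "bounded_linear l"
  shows "cont_diff l"
  unfolding cont_diff_def
  by (intro exI[of _ "\<lambda>_. l"]) (simp add: bounded_linear_imp_has_derivative[OF assms])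

lemma cont_diff_compose:
  fixes f :: "real \<Rightarrow> real"
  assumes f: "\<And>t. (f has_field_derivative f' t) (at t)" "continuous_on UNIV f'" and g: "cont_diff g"
  shows "cont_diff (\<lambda>z. f (g z))"
proof -
  obtain E where E: "\<And>z. (g has_derivative E z) (at z)" "\<And>e. continuous_on UNIV (\<lambda>z. E z e)"
    using g by (auto simp: cont_diff_def)
  have "((\<lambda>z. f (g z)) has_derivative (\<lambda>e. E z e * f' (g z))) (at z)" for z
    by (rule has_derivative_compose[OF E(1)[of z] f(1)[of "g z", unfolded has_field_derivative_def],
        THEN has_derivative_eq_rhs]) (simp add: mult.commute)
  moreover have "continuous_on UNIV (\<lambda>z. f' (g z))"
    by (rule continuous_on_compose2[OF f(2) cont_diff_continuous[OF g]]) simp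
  ultimately show ?thesis
    unfolding cont_diff_def
    by (intro exI[of _ "\<lambda>z e. E z e * f' (g z)"]) (auto intro!: continuous_intros E(2))
qed

text \<open>The map \<open>t / (1 + t)\<close> squeezes a nonnegative function into [0, 1) without
  changing its zero set; its derivative is \<open>1 / (1 + t)\<^sup>2\<close>.\<close>

lemma cont_diff_divide_one_plus:
  assumes "cont_diff \<psi>" "\<And>z. 0 \<le> \<psi> z"
  shows "cont_diff (\<lambda>z. \<psi> z / (1 + \<psi> z))"
proof -
  obtain D where D: "\<And>z. (\<psi> has_derivative D z) (at z)" "\<And>e. continuous_on UNIV (\<lambda>z. D z e)"
    using assms by (auto simp: cont_diff_def)
  have ne: "1 + \<psi> z \<noteq> 0" for z using assms(2)[of z] by linarith
  have "((\<lambda>z. \<psi> z / (1 + \<psi> z)) has_derivative (\<lambda>e. D z e / (1 + \<psi> z)\<^sup>2)) (at z)" for z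
    by (rule derivative_eq_intros D refl ne)+
       (use ne[of z] in \<open>auto simp: fun_eq_iff field_simps power2_eq_square\<close>)
  then show ?thesis
    unfolding cont_diff_def
    by (intro exI[of _ "\<lambda>z e. D z e / (1 + \<psi> z)\<^sup>2"])
       (auto intro!: continuous_intros D(2) cont_diff_continuous[OF assms(1)] simp: ne)
qed

text \<open>Each coordinate contributes its distances to the two faces, cut off at 0. The squares
  are there because \<open>max 0 t\<close> has a corner at 0 while its square is C^1.\<close>

definition box_bump :: "'a::euclidean_space \<Rightarrow> 'a \<Rightarrow> 'a \<Rightarrow> real" where
  "box_bump a b z = (\<Prod>i\<in>Basis. (max 0 ((z - a) \<bullet> i))\<^sup>2 * (max 0 ((b - z) \<bullet> i))\<^sup>2)"

lemma box_bump_nonneg: "0 \<le> box_bump a b z"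
  by (simp add: box_bump_def prod_nonneg)

lemma box_bump_eq_0_iff: "box_bump a b z = 0 \<longleftrightarrow> z \<notin> box a b"
proof -
  have "max 0 s = 0 \<longleftrightarrow> \<not> 0 < s" for s :: real by (auto simp: max_def)
  then show ?thesis
    by (simp add: box_bump_def mem_box inner_diff_left)
qed

lemma cont_diff_prod:
  assumes "finite I" "\<And>i. i \<in> I \<Longrightarrow> cont_diff (f i)"
  shows "cont_diff (\<lambda>z. \<Prod>i\<in>I. f i z)"
  using assms
proof (induction I rule: finite_induct)
  case empty
  show ?case by (auto simp: cont_diff_def intro!: exI[of _ "\<lambda>_ _. 0"])
qed (simp add: cont_diff_mult)

text \<open>Only \<open>t = 0\<close> is delicate: there the difference quotient is at most
  \<open>\<bar>h\<bar>\<close> in absolute value. Elsewhere the function agrees locally with 0 or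
  with the square.\<close>

lemma has_field_derivative_max_0_square:
  "((\<lambda>t::real. (max 0 t)\<^sup>2) has_field_derivative 2 * max 0 t) (at t)"
proof (cases "t = 0")
  case True
  have "\<bar>(max 0 h)\<^sup>2 / h\<bar> \<le> \<bar>h\<bar>" for h :: real
    by (cases "h > 0") (auto simp: max_def power2_eq_square)
  then have "((\<lambda>h::real. (max 0 h)\<^sup>2 / h) \<longlongrightarrow> 0) (at 0)"
    by (intro tendsto_rabs_zero_cancel[OF tendsto_sandwich[OF _ _ tendsto_const tendsto_rabs_zero[OF tendsto_ident_at]]])
       auto
  with True show ?thesis by (simp add: DERIV_def)
next
  case False
  then consider "t < 0" | "t > 0" by linarith
  then show ?thesis
  proof cases
    case 1
    have "((\<lambda>t::real. 0) has_field_derivative 2 * max 0 t) (at t)" using 1 by simp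
    from has_field_derivative_transform_within_open[OF this, of "{..<0}"] 1 show ?thesis by auto
  next
    case 2
    have "((\<lambda>t::real. t\<^sup>2) has_field_derivative 2 * max 0 t) (at t)"
      using 2 by (auto intro!: derivative_eq_intros)
    from has_field_derivative_transform_within_open[OF this, of "{0<..}"] 2 show ?thesis by auto
  qed
qed

lemma cont_diff_box_bump: "cont_diff (box_bump a b)"
proof -
  have sq: "cont_diff (\<lambda>z. (max 0 (g z))\<^sup>2)" if "cont_diff g" for g :: "'a \<Rightarrow> real"
    by (rule cont_diff_compose[OF has_field_derivative_max_0_square _ that])
       (intro continuous_intros)
  have l: "cont_diff (\<lambda>z. (z - a) \<bullet> i)" for i :: 'a
    unfolding cont_diff_def
    by (intro exI[of _ "\<lambda>_ e. e \<bullet> i"] conjI allI) (auto intro!: derivative_eq_intros)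
  have u: "cont_diff (\<lambda>z. (b - z) \<bullet> i)" for i :: 'a
    unfolding cont_diff_def
    by (intro exI[of _ "\<lambda>_ e. - e \<bullet> i"] conjI allI) (auto intro!: derivative_eq_intros continuous_intros)
  show ?thesis
    unfolding box_bump_def[abs_def]
    by (rule cont_diff_prod[OF finite_Basis]) (rule cont_diff_mult[OF sq[OF l] sq[OF u]])
qed

section \<open>Test functions and their products with locally integrable functions\<close>

lemma cont_diff_test_function:
  assumes "cont_diff \<phi>" "closed K" "K \<subseteq> unit_disk" "\<And>z. \<phi> z \<noteq> 0 \<Longrightarrow> z \<in> K"
  shows "test_function \<phi>"
proof -
  have "closure {z. \<phi> z \<noteq> 0} \<subseteq> K"
    using assms(2,4) by (intro closure_minimal) auto
  with assms(3) cont_diff_frechet[OF assms(1)] show ?thesis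
    unfolding test_function_def by blast
qed

lemma test_function_cont_diff:
  assumes "test_function \<phi>"
  shows "cont_diff \<phi>"
  unfolding cont_diff_def
proof (intro exI conjI allI)
  show "(\<phi> has_derivative frechet_derivative \<phi> (at z)) (at z)" for z
    using assms by (intro frechet_derivative_works[THEN iffD1]) (simp add: test_function_def)
  show "continuous_on UNIV (\<lambda>z. frechet_derivative \<phi> (at z) e)" for e
    using assms by (simp add: test_function_def)
qed

lemma test_function_support:
  assumes "test_function \<phi>"
  obtains K where "compact K" "K \<subseteq> unit_disk" "\<And>z. z \<notin> K \<Longrightarrow> \<phi> z = 0"
    "\<And>z e. z \<notin> K \<Longrightarrow> frechet_derivative \<phi> (at z) e = 0"
proof -
  define K where "K = closure {z. \<phi> z \<noteq> 0}"
  have disk: "K \<subseteq> unit_disk" using assms by (simp add: test_function_def K_def)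
  moreover have "compact K"
    unfolding compact_eq_bounded_closed
    using bounded_subset[OF bounded_ball disk] by (simp add: K_def)
  moreover have zero: "\<phi> z = 0" if "z \<notin> K" for z
    using that closure_subset[of "{z. \<phi> z \<noteq> 0}"] by (auto simp: K_def)
  moreover have "frechet_derivative \<phi> (at z) e = 0" if "z \<notin> K" for z e
  proof -
    have "open (- K)" "z \<in> - K" using that by (auto simp: K_def)
    then have "(\<phi> has_derivative (\<lambda>_. 0)) (at z)"
      by (rule has_derivative_transform_within_open[OF has_derivative_const[of 0]]) (simp add: zero)
    from frechet_derivative_at[OF this, symmetric] show ?thesis by simp
  qed
  ultimately show ?thesis using that by blast
qed

text \<open>The factor \<open>\<psi>\<close> is kept general to serve both a test function and its
  directional derivatives. On \<open>K\<close> it is bounded and measurable, and off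
  \<open>K\<close> the integrand vanishes.\<close>

lemma compact_support_integrable:
  fixes \<psi> :: "complex \<Rightarrow> real"
  assumes cont: "continuous_on UNIV \<psi>" and K: "compact K" "K \<subseteq> unit_disk"
    and zero: "\<And>z. z \<notin> K \<Longrightarrow> \<psi> z = 0" and f: "locally_integrable f"
  shows "set_integrable lebesgue unit_disk (\<lambda>z. \<psi> z *\<^sub>R f z)"
proof -
  have "K \<in> sets lebesgue" using K(1) by (simp add: borel_compact)
  moreover have "\<psi> \<in> borel_measurable (lebesgue_on K)"
    by (rule continuous_imp_measurable_on_sets_lebesgue[OF continuous_on_subset[OF cont]])
       (use \<open>K \<in> sets lebesgue\<close> in auto)
  moreover have "bounded (\<psi> ` K)"
    by (intro compact_imp_bounded compact_continuous_image continuous_on_subset[OF cont] K) auto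
  moreover have "f absolutely_integrable_on K"
    using f K by (simp add: locally_integrable_def)
  moreover have "bilinear (\<lambda>(r::real) (x::bicomplex). r *\<^sub>R x)"
    by (simp add: bilinear_conv_bounded_bilinear bounded_bilinear_scaleR)
  ultimately have "set_integrable lebesgue K (\<lambda>z. \<psi> z *\<^sub>R f z)"
    using absolutely_integrable_bounded_measurable_product by blast
  then show ?thesis
    unfolding set_integrable_def
    by (rule Bochner_Integration.integrable_cong[THEN iffD1, rotated 2])
       (use K zero in \<open>auto simp: indicator_def\<close>)
qed

lemma test_function_integrable:
  assumes "test_function \<phi>" "locally_integrable f"
  shows "set_integrable lebesgue unit_disk (\<lambda>z. \<phi> z *\<^sub>R f z)"
    and "set_integrable lebesgue unit_disk (\<lambda>z. frechet_derivative \<phi> (at z) e *\<^sub>R f z)"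
proof -
  obtain K where "compact K" "K \<subseteq> unit_disk" "\<And>z. z \<notin> K \<Longrightarrow> \<phi> z = 0"
    "\<And>z e. z \<notin> K \<Longrightarrow> frechet_derivative \<phi> (at z) e = 0"
    using test_function_support[OF assms(1)] by blast
  note K = this
  have \<phi>: "cont_diff \<phi>" using assms(1) by (rule test_function_cont_diff)
  show "set_integrable lebesgue unit_disk (\<lambda>z. \<phi> z *\<^sub>R f z)"
    by (rule compact_support_integrable[OF cont_diff_continuous[OF \<phi>] K(1,2,3) assms(2)])
  show "set_integrable lebesgue unit_disk (\<lambda>z. frechet_derivative \<phi> (at z) e *\<^sub>R f z)"
    by (rule compact_support_integrable[OF cont_diff_frechet(2)[OF \<phi>] K(1,2,4) assms(2)])
qed

text \<open>As \<open>h\<close> is only locally integrable, the argument is local: the criterion by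
  box integrals is applied to \<open>h\<close> cut off to a box whose closure lies in the disk, and
  countably many such closed boxes fill the disk.\<close>

lemma fundamental_lemma_calculus_of_variations:
  assumes h: "locally_integrable h"
    and zero: "\<And>\<phi>. test_function \<phi> \<Longrightarrow> (LINT z:unit_disk|lebesgue. \<phi> z *\<^sub>R h z) = 0"
  shows "AE z in lebesgue. z \<in> unit_disk \<longrightarrow> h z = 0"
proof -
  have int: "set_integrable lebesgue (cbox a b) h" if "cbox a b \<subseteq> unit_disk" for a b
    using h that by (simp add: locally_integrable_def)
  have int_box: "set_integrable lebesgue (box a b) h" if "cbox a b \<subseteq> unit_disk" for a b
    by (rule set_integrable_subset[OF int[OF that] _ box_subset_cbox]) simp
  have box: "(LINT z:box a b|lebesgue. h z) = 0" if ab: "cbox a b \<subseteq> unit_disk" for a b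
  proof -
    txt \<open>The $C^1$ functions $n\beta/(1+n\beta)$ with $\beta$ = \<open>box_bump a b\<close> converge boundedly
      to the indicator of the box.\<close>
    let ?\<psi> = "\<lambda>n z. real n * box_bump a b z"
    let ?\<phi> = "\<lambda>n z. ?\<psi> n z / (1 + ?\<psi> n z)"
    have nonneg: "0 \<le> ?\<psi> n z" for n z by (simp add: box_bump_nonneg)
    have in_box: "z \<in> box a b" if "?\<phi> n z \<noteq> 0" for n z
      using that box_bump_eq_0_iff[of a b z] by force
    have bounds: "0 \<le> ?\<phi> n z" "?\<phi> n z \<le> 1" for n z
      using nonneg[of n z] by (auto simp: divide_le_eq)
    have C1: "cont_diff (?\<phi> n)" for n
      by (intro cont_diff_divide_one_plus nonneg cont_diff_compose[OF _ _ cont_diff_box_bump, of "\<lambda>t. real n * t" "\<lambda>_. real n"])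
         (auto intro!: derivative_eq_intros)
    have test: "test_function (?\<phi> n)" for n
      by (rule cont_diff_test_function[OF C1 closed_cbox ab]) (use in_box box_subset_cbox in blast)
    have lim: "(\<lambda>n. ?\<phi> n z) \<longlonglongrightarrow> indicator (box a b) z" for z
    proof (cases "z \<in> box a b")
      case True
      then have "0 < box_bump a b z"
        using box_bump_eq_0_iff[of a b z] box_bump_nonneg[of a b z] by linarith
      then have "(\<lambda>n. ?\<phi> n z) \<longlonglongrightarrow> 1" by real_asymp
      with True show ?thesis by simp
    next
      case False
      then show ?thesis using box_bump_eq_0_iff[of a b z] by simp
    qed
    \<comment> \<open>The functions \<open>?\<phi> n\<close> take values in [0, 1] and vanish off
      the box, so the norm of \<open>h\<close> on the closed box, which is compact in the disk,
      dominates.\<close>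
    have "(\<lambda>n. LINT z|lebesgue. indicator unit_disk z *\<^sub>R ?\<phi> n z *\<^sub>R h z)
        \<longlonglongrightarrow> (LINT z|lebesgue. indicator (box a b) z *\<^sub>R h z)"
    proof (rule integral_dominated_convergence[where w = "\<lambda>z. norm (indicator (cbox a b) z *\<^sub>R h z)"])
      show "integrable lebesgue (\<lambda>z. norm (indicat_real (cbox a b) z *\<^sub>R h z))"
        using int[OF ab] unfolding set_integrable_def by (rule integrable_norm)
      show "(\<lambda>z. indicator (box a b) z *\<^sub>R h z) \<in> borel_measurable lebesgue"
        using int_box[OF ab] by (auto simp: set_integrable_def)
      show "(\<lambda>z. indicator unit_disk z *\<^sub>R ?\<phi> n z *\<^sub>R h z) \<in> borel_measurable lebesgue" for n
        using test_function_integrable(1)[OF test h, of n] by (auto simp: set_integrable_def)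
      have *: "indicat_real unit_disk z *\<^sub>R indicat_real (box a b) z *\<^sub>R h z
          = indicat_real (box a b) z *\<^sub>R h z" for z
        using ab box_subset_cbox[of a b] by (auto simp: indicator_def)
      have "(\<lambda>n. indicat_real unit_disk z *\<^sub>R ?\<phi> n z *\<^sub>R h z)
          \<longlonglongrightarrow> indicat_real unit_disk z *\<^sub>R indicat_real (box a b) z *\<^sub>R h z" for z
        by (rule tendsto_scaleR[OF tendsto_const tendsto_scaleR[OF lim tendsto_const]])
      then show "AE z in lebesgue. (\<lambda>n. indicator unit_disk z *\<^sub>R ?\<phi> n z *\<^sub>R h z)
          \<longlonglongrightarrow> indicator (box a b) z *\<^sub>R h z"
        unfolding * by (intro AE_I2)
      show "AE z in lebesgue. norm (indicator unit_disk z *\<^sub>R ?\<phi> n z *\<^sub>R h z)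
          \<le> norm (indicat_real (cbox a b) z *\<^sub>R h z)" for n
      proof (intro AE_I2)
        fix z
        show "norm (indicator unit_disk z *\<^sub>R ?\<phi> n z *\<^sub>R h z) \<le> norm (indicat_real (cbox a b) z *\<^sub>R h z)"
        proof (cases "z \<in> box a b")
          case True
          then have "z \<in> cbox a b" using box_subset_cbox by blast
          moreover have "\<bar>?\<phi> n z\<bar> * norm (h z) \<le> 1 * norm (h z)"
            using bounds[where n=n and z=z] by (intro mult_right_mono) (simp_all only: abs_of_nonneg norm_ge_zero)
          ultimately show ?thesis by (simp add: indicator_def)
        next
          case False
          then have "?\<phi> n z = 0" using in_box by blast
          then show ?thesis by (simp only: scaleR_zero_left scaleR_zero_right norm_zero norm_ge_zero)
        qed
      qed
    qed
    then show ?thesis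
      using zero[OF test] by (simp add: set_lebesgue_integral_def LIMSEQ_const_iff)
  qed
  have cbox: "AE z in lebesgue. z \<in> cbox a b \<longrightarrow> h z = 0" if ab: "cbox a b \<subseteq> unit_disk" for a b
  proof -
    have "AE z in lebesgue. indicator (box a b) z *\<^sub>R h z = 0"
    proof (rule AE_zero_if_box_integrals_zero)
      show "integrable lebesgue (\<lambda>z. indicat_real (box a b) z *\<^sub>R h z)"
        using int_box[OF ab] by (auto simp: set_integrable_def)
      fix c d :: complex
      \<comment> \<open>These are the corners of \<open>box c d \<inter> box a b\<close>, which is
        again a box with closed hull in the disk.\<close>
      let ?l = "\<Sum>i\<in>Basis. max (c \<bullet> i) (a \<bullet> i) *\<^sub>R i :: complex"
      let ?u = "\<Sum>i\<in>Basis. min (d \<bullet> i) (b \<bullet> i) *\<^sub>R i :: complex"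
      have "cbox ?l ?u \<subseteq> cbox a b" by (auto simp: mem_box)
      then have "(LINT z:box ?l ?u|lebesgue. h z) = 0" using ab by (intro box) auto
      moreover have "box ?l ?u = box c d \<inter> box a b" by (simp add: box_Int_box)
      ultimately show "(LINT z:box c d|lebesgue. indicat_real (box a b) z *\<^sub>R h z) = 0"
        by (simp add: set_lebesgue_integral_def indicator_inter_arith)
    qed
    \<comment> \<open>The cover below uses closed boxes; their faces are null sets.\<close>
    moreover have "cbox a b - box a b \<in> null_sets lebesgue"
      using negligible_frontier_interval negligible_iff_null_sets by blast
    then have "AE z in lebesgue. z \<notin> cbox a b - box a b" by (rule AE_not_in)
    ultimately show ?thesis
      by eventually_elim (auto simp: indicator_def)
  qed
  obtain \<D> where D: "countable \<D>" "\<D> \<subseteq> Pow unit_disk" "\<And>X. X \<in> \<D> \<Longrightarrow> \<exists>a b. X = cbox a b"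
      "\<Union>\<D> = unit_disk"
    using open_countable_Union_open_cbox[OF open_ball] by metis
  have "AE z in lebesgue. \<forall>X\<in>\<D>. z \<in> X \<longrightarrow> h z = 0"
    unfolding AE_ball_countable[OF D(1)]
  proof
    fix X assume X: "X \<in> \<D>"
    then obtain a b where "X = cbox a b" using D(3) by blast
    with X D(2) cbox[of a b] show "AE z in lebesgue. z \<in> X \<longrightarrow> h z = 0" by auto
  qed
  then show ?thesis
    by eventually_elim (use D(4) in blast)
qed

subsection \<open>Multiplication by bicomplexified numbers\<close>

text \<open>Multiplication by a bicomplexified number becomes two real scalings and the fixed linear
  map \<open>w \<mapsto> bc_j * w\<close>. The bicomplex norm is not submultiplicative
  (\<open>bc_p_plus\<close> is idempotent of norm below 1), so measurability and weak derivatives of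
  products are obtained through this splitting.\<close>

lemma bc_hat_mult: "bc_hat z * w = Re z *\<^sub>R w + Im z *\<^sub>R (bc_j * w)"
  by (simp add: bicomplex_eq_iff bc_hat_def bc_j_def complex_eq_iff)

lemma bounded_linear_bc_j: "bounded_linear (\<lambda>w. bc_j * w)"
  by (intro linear_conv_bounded_linear[THEN iffD1] linearI) (simp_all add: algebra_simps)

text \<open>In idempotent coordinates \<open>bc_hat z\<close> acts as \<open>cnj z\<close> on the
  plus part and as \<open>z\<close> on the minus part, and both have modulus
  \<open>cmod z\<close>.\<close>

lemma norm_bc_hat_mult: "norm (bc_hat z * w) = cmod z * norm w"
proof -
  have "bc_plus (bc_hat z * w) = cnj z * bc_plus w" "bc_minus (bc_hat z * w) = z * bc_minus w"
    by (simp_all add: bc_plus_def bc_minus_def bc_hat_def complex_eq_iff algebra_simps)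
  then show ?thesis
    by (simp add: norm_bicomplex_def norm_mult power_mult_distrib real_sqrt_mult
        flip: distrib_left times_divide_eq_right)
qed

lemma norm_bc_hat_power_mult: "norm (bc_hat z ^ k * w) = cmod z ^ k * norm w"
  by (induction k) (simp_all add: mult.assoc norm_bc_hat_mult)

lemma borel_measurable_bc_hat_power_mult:
  assumes "u \<in> borel_measurable borel"
  shows "(\<lambda>z. bc_hat (cnj z) ^ k * u z) \<in> borel_measurable borel"
proof (induction k)
  case (Suc k)
  have "(\<lambda>z. bc_j * (bc_hat (cnj z) ^ k * u z)) \<in> borel_measurable borel"
    by (rule measurable_compose[OF Suc])
       (intro borel_measurable_continuous_onI linear_continuous_on bounded_linear_bc_j)
  with Suc have "(\<lambda>z. Re z *\<^sub>R (bc_hat (cnj z) ^ k * u z)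
      + (- Im z) *\<^sub>R (bc_j * (bc_hat (cnj z) ^ k * u z))) \<in> borel_measurable borel"
    by measurable
  moreover have "bc_hat (cnj z) ^ Suc k * u z = Re z *\<^sub>R (bc_hat (cnj z) ^ k * u z)
      + (- Im z) *\<^sub>R (bc_j * (bc_hat (cnj z) ^ k * u z))" for z
    using bc_hat_mult[of "cnj z" "bc_hat (cnj z) ^ k * u z"] by (simp only: power_Suc mult.assoc cnj.sel)
  ultimately show ?case by (simp only:)
qed (use assms in simp)

subsection \<open>Calculus of weak derivatives\<close>

lemma locally_integrable_add:
  "locally_integrable f \<Longrightarrow> locally_integrable g \<Longrightarrow> locally_integrable (\<lambda>z. f z + g z)"
  by (auto simp: locally_integrable_def intro: set_integral_add)

lemma locally_integrable_bounded_linear: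
  assumes "bounded_linear T" "locally_integrable f"
  shows "locally_integrable (\<lambda>z. T (f z))"
  using assms(2) absolutely_integrable_linear[OF _ assms(1)] by (auto simp: locally_integrable_def o_def)

lemma locally_integrable_mult_linear:
  assumes l: "bounded_linear l" and f: "locally_integrable f"
  shows "locally_integrable (\<lambda>z. l z *\<^sub>R f z)"
  unfolding locally_integrable_def
proof (intro allI impI)
  fix K :: "complex set" assume K: "compact K \<and> K \<subseteq> unit_disk"
  have cont: "continuous_on K l" using l by (rule linear_continuous_on)
  have leb: "K \<in> sets lebesgue" using K by (simp add: borel_compact)
  have "bilinear (\<lambda>(r::real) (x::bicomplex). r *\<^sub>R x)"
    by (simp add: bilinear_conv_bounded_bilinear bounded_bilinear_scaleR)
  moreover have "l \<in> borel_measurable (lebesgue_on K)"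
    by (rule continuous_imp_measurable_on_sets_lebesgue[OF cont leb])
  moreover have "bounded (l ` K)"
    using K cont by (intro compact_imp_bounded compact_continuous_image) auto
  moreover have "f absolutely_integrable_on K"
    using f K by (simp add: locally_integrable_def)
  ultimately show "(\<lambda>z. l z *\<^sub>R f z) absolutely_integrable_on K"
    using absolutely_integrable_bounded_measurable_product leb by blast
qed

lemma locally_integrable_cong_AE:
  assumes "locally_integrable f" "AE z in lebesgue. z \<in> unit_disk \<longrightarrow> f z = g z"
  shows "locally_integrable g"
  unfolding locally_integrable_def
proof (intro allI impI)
  fix K :: "complex set" assume K: "compact K \<and> K \<subseteq> unit_disk"
  then have f: "f absolutely_integrable_on K"
    using assms(1) by (simp add: locally_integrable_def)
  obtain N where N: "negligible N" "{z. \<not> (z \<in> unit_disk \<longrightarrow> f z = g z)} \<subseteq> N"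
    using assms(2) by (auto simp: eventually_ae_filter_negligible)
  show "g absolutely_integrable_on K"
  proof (rule absolutely_integrable_spike[OF f N(1)])
    fix x assume "x \<in> K - N"
    then have "x \<in> unit_disk" "x \<notin> {z. \<not> (z \<in> unit_disk \<longrightarrow> f z = g z)}" using K N(2) by blast+
    then show "g x = f x" by simp
  qed
qed

lemma has_weak_partialD:
  assumes "has_weak_partial e f g"
  shows "locally_integrable f" "locally_integrable g"
    "test_function \<phi> \<Longrightarrow> (LINT z:unit_disk|lebesgue. frechet_derivative \<phi> (at z) e *\<^sub>R f z)
          = - (LINT z:unit_disk|lebesgue. \<phi> z *\<^sub>R g z)"
  using assms unfolding has_weak_partial_def by blast+

text \<open>Both candidates pair equally with every test function, so the fundamental lemma applies
  to their difference. This makes the choice in \<open>weak_partial\<close> harmless.\<close>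

lemma has_weak_partial_unique:
  assumes "has_weak_partial e f g" "has_weak_partial e f g'"
  shows "AE z in lebesgue. z \<in> unit_disk \<longrightarrow> g z = g' z"
proof -
  note li = has_weak_partialD(2)[OF assms(1)] has_weak_partialD(2)[OF assms(2)]
  have "locally_integrable (\<lambda>z. g z - g' z)"
    using li by (auto simp: locally_integrable_def intro: set_integral_diff)
  moreover have "(LINT z:unit_disk|lebesgue. \<phi> z *\<^sub>R (g z - g' z)) = 0" if "test_function \<phi>" for \<phi>
    using has_weak_partialD(3)[OF assms(1) that] has_weak_partialD(3)[OF assms(2) that]
    by (simp add: scaleR_diff_right set_integral_diff(2) test_function_integrable(1)[OF that] li)
  ultimately show ?thesis
    using fundamental_lemma_calculus_of_variations[of "\<lambda>z. g z - g' z"] by simp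
qed

lemma has_weak_partial_cong_AE:
  assumes "has_weak_partial e f g" and ae: "AE z in lebesgue. z \<in> unit_disk \<longrightarrow> f z = f' z"
  shows "has_weak_partial e f' g"
  unfolding has_weak_partial_def
proof (intro conjI allI impI)
  show f': "locally_integrable f'"
    using has_weak_partialD(1)[OF assms(1)] ae by (rule locally_integrable_cong_AE)
  fix \<phi> assume \<phi>: "test_function \<phi>"
  have "(LINT z:unit_disk|lebesgue. frechet_derivative \<phi> (at z) e *\<^sub>R f' z)
      = (LINT z:unit_disk|lebesgue. frechet_derivative \<phi> (at z) e *\<^sub>R f z)"
    unfolding set_lebesgue_integral_def
    using test_function_integrable(2)[OF \<phi>] has_weak_partialD(1)[OF assms(1)] f' ae
    by (intro integral_cong_AE) (auto simp: set_integrable_def indicator_def elim: eventually_mono)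
  with has_weak_partialD(3)[OF assms(1) \<phi>]
  show "(LINT z:unit_disk|lebesgue. frechet_derivative \<phi> (at z) e *\<^sub>R f' z)
      = - (LINT z:unit_disk|lebesgue. \<phi> z *\<^sub>R g z)" by simp
qed (rule has_weak_partialD(2)[OF assms(1)])

lemma has_weak_partial_add:
  assumes f: "has_weak_partial e f f'" and g: "has_weak_partial e g g'"
  shows "has_weak_partial e (\<lambda>z. f z + g z) (\<lambda>z. f' z + g' z)"
  unfolding has_weak_partial_def
  using has_weak_partialD[OF f] has_weak_partialD[OF g]
  by (auto simp: scaleR_add_right set_integral_add test_function_integrable locally_integrable_add)

lemma has_weak_partial_bounded_linear:
  assumes T: "bounded_linear T" and f: "has_weak_partial e f g"
  shows "has_weak_partial e (\<lambda>z. T (f z)) (\<lambda>z. T (g z))"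
proof -
  interpret T: bounded_linear T by fact
  have "(LINT z:unit_disk|lebesgue. \<psi> z *\<^sub>R T (h z)) = T (LINT z:unit_disk|lebesgue. \<psi> z *\<^sub>R h z)"
    if "set_integrable lebesgue unit_disk (\<lambda>z. \<psi> z *\<^sub>R h z)" for \<psi> :: "complex \<Rightarrow> real" and h
    using integral_bounded_linear[OF T that[unfolded set_integrable_def]]
    by (simp add: set_lebesgue_integral_def T.scaleR)
  then show ?thesis
    unfolding has_weak_partial_def using has_weak_partialD[OF f]
    by (auto simp: test_function_integrable locally_integrable_bounded_linear[OF T] T.neg)
qed

text \<open>With \<open>\<phi>\<close> also \<open>l z * \<phi> z\<close> is a test function.
  Testing \<open>f\<close> against it and expanding its derivative gives the rule; the derivative of
  \<open>l\<close> in direction \<open>e\<close> is the constant \<open>l e\<close>.\<close>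

lemma has_weak_partial_mult_linear:
  assumes l: "bounded_linear l" and f: "has_weak_partial e f g"
  shows "has_weak_partial e (\<lambda>z. l z *\<^sub>R f z) (\<lambda>z. l e *\<^sub>R f z + l z *\<^sub>R g z)"
  unfolding has_weak_partial_def
proof (intro conjI allI impI)
  note li = has_weak_partialD(1,2)[OF f]
  have lf: "locally_integrable (\<lambda>z. l e *\<^sub>R f z)"
    by (rule locally_integrable_bounded_linear[OF bounded_linear_scaleR_right li(1)])
  note lfg = locally_integrable_mult_linear[OF l li(1)] locally_integrable_mult_linear[OF l li(2)]
  show "locally_integrable (\<lambda>z. l z *\<^sub>R f z)" by fact
  show "locally_integrable (\<lambda>z. l e *\<^sub>R f z + l z *\<^sub>R g z)"
    by (intro locally_integrable_add lf lfg)
  fix \<phi> assume \<phi>: "test_function \<phi>"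
  let ?\<psi> = "\<lambda>z. l z * \<phi> z"
  have \<psi>: "test_function ?\<psi>"
  proof -
    obtain K where K: "compact K" "K \<subseteq> unit_disk" "\<And>z. z \<notin> K \<Longrightarrow> \<phi> z = 0"
      using test_function_support[OF \<phi>] by metis
    have "cont_diff ?\<psi>"
      using cont_diff_mult[OF cont_diff_bounded_linear[OF l] test_function_cont_diff[OF \<phi>]] .
    then show ?thesis
      by (rule cont_diff_test_function[OF _ compact_imp_closed[OF K(1)] K(2)]) (metis K(3) mult_zero_right)
  qed
  have D: "frechet_derivative ?\<psi> (at z) e = l z * frechet_derivative \<phi> (at z) e + l e * \<phi> z" for z
  proof -
    have "(\<phi> has_derivative frechet_derivative \<phi> (at z)) (at z)"
      using \<phi> by (intro frechet_derivative_works[THEN iffD1]) (simp add: test_function_def)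
    from frechet_derivative_at[OF has_derivative_mult[OF bounded_linear_imp_has_derivative[OF l] this]]
    show ?thesis by (rule fun_cong[OF sym])
  qed
  have "frechet_derivative \<phi> (at z) e *\<^sub>R l z *\<^sub>R f z
      = frechet_derivative ?\<psi> (at z) e *\<^sub>R f z - \<phi> z *\<^sub>R l e *\<^sub>R f z" for z
    unfolding D by (simp add: algebra_simps)
  then have "(LINT z:unit_disk|lebesgue. frechet_derivative \<phi> (at z) e *\<^sub>R l z *\<^sub>R f z)
      = (LINT z:unit_disk|lebesgue. frechet_derivative ?\<psi> (at z) e *\<^sub>R f z - \<phi> z *\<^sub>R l e *\<^sub>R f z)"
    by (simp only:)
  also have "\<dots> = (LINT z:unit_disk|lebesgue. frechet_derivative ?\<psi> (at z) e *\<^sub>R f z)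
      - (LINT z:unit_disk|lebesgue. \<phi> z *\<^sub>R l e *\<^sub>R f z)"
    by (intro set_integral_diff(2) test_function_integrable \<phi> \<psi> li lf)
  also have "(LINT z:unit_disk|lebesgue. frechet_derivative ?\<psi> (at z) e *\<^sub>R f z)
      = - (LINT z:unit_disk|lebesgue. \<phi> z *\<^sub>R l z *\<^sub>R g z)"
    using has_weak_partialD(3)[OF f \<psi>] by (simp add: mult.commute)
  also have "- (LINT z:unit_disk|lebesgue. \<phi> z *\<^sub>R l z *\<^sub>R g z)
        - (LINT z:unit_disk|lebesgue. \<phi> z *\<^sub>R l e *\<^sub>R f z)
      = - (LINT z:unit_disk|lebesgue. \<phi> z *\<^sub>R (l e *\<^sub>R f z + l z *\<^sub>R g z))"
    by (simp add: scaleR_add_right set_integral_add(2)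
        test_function_integrable(1)[OF \<phi> lf, simplified] test_function_integrable(1)[OF \<phi> lfg(2), simplified])
  finally show "(LINT z:unit_disk|lebesgue. frechet_derivative \<phi> (at z) e *\<^sub>R l z *\<^sub>R f z)
      = - (LINT z:unit_disk|lebesgue. \<phi> z *\<^sub>R (l e *\<^sub>R f z + l z *\<^sub>R g z))" .
qed

lemma has_weak_partial_bc_hat_mult:
  assumes "has_weak_partial e f g"
  shows "has_weak_partial e (\<lambda>z. bc_hat (cnj z) * f z)
    (\<lambda>z. bc_hat (cnj e) * f z + bc_hat (cnj z) * g z)"
proof -
  have l: "bounded_linear (\<lambda>z. - Im z)"
    by (intro bounded_linear_minus bounded_linear_Im)
  note Re = has_weak_partial_mult_linear[OF bounded_linear_Re assms]
  note Im = has_weak_partial_mult_linear[OF l has_weak_partial_bounded_linear[OF bounded_linear_bc_j assms]]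
  from has_weak_partial_add[OF Re Im]
  have "has_weak_partial e (\<lambda>z. Re z *\<^sub>R f z + (- Im z) *\<^sub>R (bc_j * f z))
    (\<lambda>z. (Re e *\<^sub>R f z + Re z *\<^sub>R g z) + ((- Im e) *\<^sub>R (bc_j * f z) + (- Im z) *\<^sub>R (bc_j * g z)))" .
  then show ?thesis by (simp only: bc_hat_mult cnj.sel add_ac)
qed

text \<open>Each induction step splits off one factor. At \<open>k = 0\<close> the truncated
  exponent \<open>k - 1\<close> is masked by the coefficient \<open>real k\<close>.\<close>

lemma has_weak_partial_bc_hat_power_mult:
  assumes "has_weak_partial e f g"
  shows "has_weak_partial e (\<lambda>z. bc_hat (cnj z) ^ k * f z)
    (\<lambda>z. real k *\<^sub>R (bc_hat (cnj e) * (bc_hat (cnj z) ^ (k - 1) * f z)) + bc_hat (cnj z) ^ k * g z)"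
proof (induction k)
  case (Suc k)
  have "bc_hat (cnj z) * (real k *\<^sub>R (bc_hat (cnj e) * (bc_hat (cnj z) ^ (k - 1) * f z))
        + bc_hat (cnj z) ^ k * g z)
      = real k *\<^sub>R (bc_hat (cnj e) * (bc_hat (cnj z) ^ k * f z)) + bc_hat (cnj z) ^ Suc k * g z" for z
    by (cases k) (simp_all add: distrib_left mult_ac)
  with has_weak_partial_bc_hat_mult[OF Suc] show ?case
    by (simp add: scaleR_left_distrib mult.assoc add.assoc)
qed (use assms in simp)

lemma has_weak_partial_sum:
  assumes "finite I" "\<And>i. i \<in> I \<Longrightarrow> has_weak_partial e (f i) (g i)"
  shows "has_weak_partial e (\<lambda>z. \<Sum>i\<in>I. f i z) (\<lambda>z. \<Sum>i\<in>I. g i z)"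
  using assms
proof (induction I rule: finite_induct)
  case empty
  show ?case by (simp add: has_weak_partial_def locally_integrable_def set_integrable_def)
qed (simp add: has_weak_partial_add)

lemma weakly_differentiable_has_weak_partial:
  assumes "weakly_differentiable f"
  shows "has_weak_partial 1 f (weak_partial 1 f)" "has_weak_partial \<i> f (weak_partial \<i> f)"
  using assms someI_ex[of "has_weak_partial 1 f"] someI_ex[of "has_weak_partial \<i> f"]
  unfolding weakly_differentiable_def weak_partial_def by blast+

subsection \<open>Iterates of the Beltrami operator\<close>

text \<open>\<open>beltrami_op \<mu> f z\<close> as a function of $\mu(z)$, $f_x(z)$ and $f_y(z)$.\<close>

definition beltrami_symbol :: "bicomplex \<Rightarrow> bicomplex \<Rightarrow> bicomplex \<Rightarrow> bicomplex" where
  "beltrami_symbol m x y = (1/2) *\<^sub>R (x + bc_j * y) - m * ((1/2) *\<^sub>R (x - bc_j * y))"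

lemma beltrami_symbol_add:
  "beltrami_symbol m (x + x') (y + y') = beltrami_symbol m x y + beltrami_symbol m x' y'"
  by (simp add: beltrami_symbol_def algebra_simps)

lemma beltrami_symbol_scaleR: "beltrami_symbol m (r *\<^sub>R x) (r *\<^sub>R y) = r *\<^sub>R beltrami_symbol m x y"
  by (simp add: beltrami_symbol_def algebra_simps)

lemma beltrami_symbol_mult: "beltrami_symbol m (v * x) (v * y) = v * beltrami_symbol m x y"
  by (simp add: beltrami_symbol_def algebra_simps)

lemma beltrami_symbol_sum:
  "beltrami_symbol m (\<Sum>k\<in>I. x k) (\<Sum>k\<in>I. y k) = (\<Sum>k\<in>I. beltrami_symbol m (x k) (y k))"
proof (induction I rule: infinite_finite_induct)
  case (insert k I)
  then show ?case by (simp add: beltrami_symbol_add)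
qed (simp_all add: beltrami_symbol_def)

text \<open>This is $L\zeta = 1$: the derivatives of \<open>bc_hat (cnj z)\<close> in the directions \<open>1\<close> and \<open>\<i>\<close>
  are \<open>bc_hat (cnj 1)\<close> and \<open>bc_hat (cnj \<i>)\<close>.\<close>

lemma beltrami_symbol_bc_hat_cnj:
  "beltrami_symbol m (bc_hat (cnj 1) * v) (bc_hat (cnj \<i>) * v) = v"
proof -
  \<comment> \<open>So \<open>x = v\<close> and \<open>y = - bc_j * v\<close>, whence
    \<open>bc_j * y = v\<close>: the part \<open>x - bc_j * y\<close> multiplied by \<open>m\<close>
    vanishes and the other one is \<open>v\<close>.\<close>
  have hat: "bc_hat (cnj 1) = 1" "bc_hat (cnj \<i>) = - bc_j"
    by (simp_all add: bicomplex_eq_iff bc_hat_def bc_j_def)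
  have jj: "bc_j * (bc_j * v) = - v"
    using bc_j_squared by (simp flip: mult.assoc)
  have "(1/2) *\<^sub>R (v + v) = v" by (simp flip: scaleR_2)
  with jj show ?thesis
    unfolding beltrami_symbol_def hat by (simp add: jj flip: scaleR_add_right)
qed

lemma beltrami_op_AE:
  assumes "has_weak_partial 1 f g" "has_weak_partial \<i> f h"
  shows "AE z in lebesgue. z \<in> unit_disk \<longrightarrow> beltrami_op \<mu> f z = beltrami_symbol (\<mu> z) (g z) (h z)"
proof -
  have "weakly_differentiable f" using assms by (auto simp: weakly_differentiable_def)
  note wd = weakly_differentiable_has_weak_partial[OF this]
  show ?thesis
    using has_weak_partial_unique[OF wd(1) assms(1)] has_weak_partial_unique[OF wd(2) assms(2)]
    by eventually_elim (simp add: beltrami_op_def bc_del_def bc_delbar_def beltrami_symbol_def)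
qed

text \<open>Free coefficients and exponents, and an equation for \<open>F\<close> that holds only
  a.e., make the conclusion usable as the next hypothesis. In each term the symbol of the
  derivatives of \<open>wk k\<close> is 0, so only the derivative of the power survives.\<close>

lemma beltrami_op_bc_hat_power_sum:
  fixes c :: "nat \<Rightarrow> real" and d :: "nat \<Rightarrow> nat"
  assumes sol: "\<And>k. k < n \<Longrightarrow> solves_beltrami \<mu> (wk k)"
    and F: "AE z in lebesgue. z \<in> unit_disk
      \<longrightarrow> F z = (\<Sum>k<n. c k *\<^sub>R (bc_hat (cnj z) ^ d k * wk k z))"
  shows "weakly_differentiable F"
    and "AE z in lebesgue. z \<in> unit_disk
      \<longrightarrow> beltrami_op \<mu> F z = (\<Sum>k<n. (c k * real (d k)) *\<^sub>R (bc_hat (cnj z) ^ (d k - 1) * wk k z))"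
proof -
  define G where "G e z = (\<Sum>k<n. c k *\<^sub>R (real (d k) *\<^sub>R (bc_hat (cnj e) * (bc_hat (cnj z) ^ (d k - 1) * wk k z))
      + bc_hat (cnj z) ^ d k * weak_partial e (wk k) z))" for e z
  \<comment> \<open>The premise is there because \<open>weak_partial e\<close> is known to be a weak
    derivative only in the directions \<open>1\<close> and \<open>\<i>\<close>.\<close>
  have G: "has_weak_partial e F (G e)"
    if wd: "\<And>k. k < n \<Longrightarrow> has_weak_partial e (wk k) (weak_partial e (wk k))" for e
  proof -
    have "has_weak_partial e (\<lambda>z. \<Sum>k<n. c k *\<^sub>R (bc_hat (cnj z) ^ d k * wk k z)) (G e)"
      unfolding G_def[abs_def]
      by (rule has_weak_partial_sum[OF finite_lessThan has_weak_partial_bounded_linear[OF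
          bounded_linear_scaleR_right has_weak_partial_bc_hat_power_mult[OF wd]]]) simp
    then show ?thesis
      by (rule has_weak_partial_cong_AE) (use F in \<open>auto elim: eventually_mono\<close>)
  qed
  have wd: "has_weak_partial 1 (wk k) (weak_partial 1 (wk k))"
    "has_weak_partial \<i> (wk k) (weak_partial \<i> (wk k))" if "k < n" for k
    using sol[OF that] weakly_differentiable_has_weak_partial by (auto simp: solves_beltrami_def)
  have G1: "has_weak_partial 1 F (G 1)" and Gi: "has_weak_partial \<i> F (G \<i>)"
    by (rule G, rule wd, assumption)+
  show "weakly_differentiable F"
    using G1 Gi unfolding weakly_differentiable_def by blast
  \<comment> \<open>The exceptional sets of the finitely many equations are merged into one null
    set.\<close>
  have "AE z in lebesgue. \<forall>k\<in>{..<n}. z \<in> unit_disk \<longrightarrow> bc_delbar (wk k) z = \<mu> z * bc_del (wk k) z"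
    using sol by (subst AE_ball_countable) (auto simp: solves_beltrami_def)
  with beltrami_op_AE[OF G1 Gi]
  show "AE z in lebesgue. z \<in> unit_disk
      \<longrightarrow> beltrami_op \<mu> F z = (\<Sum>k<n. (c k * real (d k)) *\<^sub>R (bc_hat (cnj z) ^ (d k - 1) * wk k z))"
  proof (eventually_elim, intro impI)
    fix z assume z: "z \<in> unit_disk"
    assume "z \<in> unit_disk \<longrightarrow> beltrami_op \<mu> F z = beltrami_symbol (\<mu> z) (G 1 z) (G \<i> z)"
    then have op: "beltrami_op \<mu> F z = beltrami_symbol (\<mu> z) (G 1 z) (G \<i> z)"
      using z by simp
    assume sol: "\<forall>k\<in>{..<n}. z \<in> unit_disk \<longrightarrow> bc_delbar (wk k) z = \<mu> z * bc_del (wk k) z"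
    have "beltrami_symbol (\<mu> z) (weak_partial 1 (wk k) z) (weak_partial \<i> (wk k) z) = 0" if "k < n" for k
      using sol that z by (simp add: beltrami_symbol_def bc_del_def bc_delbar_def)
    then show "beltrami_op \<mu> F z
        = (\<Sum>k<n. (c k * real (d k)) *\<^sub>R (bc_hat (cnj z) ^ (d k - 1) * wk k z))"
      unfolding op G_def beltrami_symbol_sum beltrami_symbol_scaleR beltrami_symbol_add
        beltrami_symbol_mult beltrami_symbol_bc_hat_cnj
      by (intro sum.cong) simp_all
  qed
qed

text \<open>Subtraction on \<^typ>\<open>nat\<close> is truncated, so the coefficient vanishes for \<open>k < m\<close>.\<close>

lemma beltrami_op_power_bc_hat_sum:
  assumes sol: "\<And>k. k < n \<Longrightarrow> solves_beltrami \<mu> (wk k)"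
    and w: "\<And>z. z \<in> unit_disk \<Longrightarrow> w z = (\<Sum>k<n. bc_hat (cnj z) ^ k * wk k z)"
  shows "AE z in lebesgue. z \<in> unit_disk \<longrightarrow> (beltrami_op \<mu> ^^ m) w z
    = (\<Sum>k<n. (\<Prod>i<m. real (k - i)) *\<^sub>R (bc_hat (cnj z) ^ (k - m) * wk k z))"
proof (induction m)
  case 0
  show ?case by (intro AE_I2) (simp add: w)
next
  case (Suc m)
  show ?case
    using beltrami_op_bc_hat_power_sum(2)[OF sol Suc] by simp
qed

lemma solves_beltrami_iterated_bc_hat_sum:
  assumes sol: "\<And>k. k < n \<Longrightarrow> solves_beltrami \<mu> (wk k)"
    and w: "\<And>z. z \<in> unit_disk \<Longrightarrow> w z = (\<Sum>k<n. bc_hat (cnj z) ^ k * wk k z)"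
  shows "solves_beltrami_iterated n \<mu> w"
  unfolding solves_beltrami_iterated_def
proof (intro conjI allI impI)
  note pow = beltrami_op_power_bc_hat_sum[OF sol w]
  show "weakly_differentiable ((beltrami_op \<mu> ^^ k) w)" for k
    by (rule beltrami_op_bc_hat_power_sum(1)[OF sol pow])
  have "(\<Sum>k<n. (\<Prod>i<n. real (k - i)) *\<^sub>R (bc_hat (cnj z) ^ (k - n) * wk k z)) = 0" for z
  proof (intro sum.neutral ballI)
    fix k assume "k \<in> {..<n}"
    \<comment> \<open>The factor with \<open>i = k\<close> is 0, and it occurs because
      \<open>k < n\<close>.\<close>
    then have "(\<Prod>i<n. real (k - i)) = 0"
      by (intro prod_zero bexI[of _ k]) auto
    then show "(\<Prod>i<n. real (k - i)) *\<^sub>R (bc_hat (cnj z) ^ (k - n) * wk k z) = 0"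
      by (simp only: scaleR_zero_left)
  qed
  with pow[of n] show "AE z in lebesgue. z \<in> unit_disk \<longrightarrow> (beltrami_op \<mu> ^^ n) w z = 0"
    by (simp only:)
qed

subsection \<open>Finiteness of the Hardy norms\<close>

text \<open>An infimum over representatives is finite iff one representative has a finite value.
  This is therefore the common content of the two finiteness conditions, whose normalisations and
  root do not affect finiteness.\<close>

definition bounded_circle_integrals :: "real \<Rightarrow> (complex \<Rightarrow> bicomplex) \<Rightarrow> bool" where
  "bounded_circle_integrals p v \<longleftrightarrow>
     (\<exists>u\<in>representatives v. (SUP r\<in>{0<..<1}. circle_integral p u r) < \<infinity>)"

lemma circle_sup_less_top_iff: "circle_sup p v < \<infinity> \<longleftrightarrow> bounded_circle_integrals p v"
  by (simp add: circle_sup_def bounded_circle_integrals_def INF_less_iff)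

lemma hardy_norm_less_top_iff: "hardy_norm p v < \<infinity> \<longleftrightarrow> bounded_circle_integrals p v"
proof -
  have "ennreal_root p x < \<infinity> \<longleftrightarrow> x < \<infinity>" for x
    by (auto simp: ennreal_root_def less_top)
  moreover have "ennreal (1 / (2 * pi)) * x < \<infinity> \<longleftrightarrow> x < \<infinity>" for x
    by (auto simp: ennreal_mult_less_top)
  ultimately show ?thesis
    by (simp add: hardy_norm_def bounded_circle_integrals_def INF_less_iff flip: SUP_mult_left_ennreal)
qed

text \<open>Minkowski's inequality fails for \<open>p < 1\<close>; for every positive
  \<open>p\<close> the pointwise bound through \<open>2 * max (norm a) (norm b)\<close> costs only
  the factor \<open>2 powr p\<close>.\<close>

lemma bounded_circle_integrals_add:
  assumes p: "0 < p" and v: "bounded_circle_integrals p v" "bounded_circle_integrals p v'"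
  shows "bounded_circle_integrals p (\<lambda>z. v z + v' z)"
proof -
  obtain u where u: "u \<in> representatives v" and fin: "(SUP r\<in>{0<..<1}. circle_integral p u r) < \<infinity>"
    using v(1) by (auto simp: bounded_circle_integrals_def)
  obtain u' where u': "u' \<in> representatives v'" and fin': "(SUP r\<in>{0<..<1}. circle_integral p u' r) < \<infinity>"
    using v(2) by (auto simp: bounded_circle_integrals_def)
  have [measurable]: "u \<in> borel_measurable borel" "u' \<in> borel_measurable borel"
    using u u' by (auto simp: representatives_def)
  have rep: "(\<lambda>z. u z + u' z) \<in> representatives (\<lambda>z. v z + v' z)"
    using u u' by (auto simp: representatives_def elim: eventually_elim2)
  have [measurable]: "(\<lambda>\<theta>. of_real r * cis \<theta>) \<in> borel_measurable borel" for r
    by (intro borel_measurable_continuous_onI continuous_intros)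
  have powr: "norm (a + b) powr p \<le> 2 powr p * (norm a powr p + norm b powr p)" for a b :: bicomplex
  proof -
    have "norm (a + b) powr p \<le> (2 * max (norm a) (norm b)) powr p"
      using p norm_triangle_ineq[of a b] by (intro powr_mono2) auto
    also have "\<dots> = 2 powr p * max (norm a) (norm b) powr p"
      by (simp add: powr_mult)
    also have "max (norm a) (norm b) powr p \<le> norm a powr p + norm b powr p"
      by (simp add: max_def)
    finally show ?thesis by simp
  qed
  have "circle_integral p (\<lambda>z. u z + u' z) r
      \<le> ennreal (2 powr p) * (circle_integral p u r + circle_integral p u' r)" for r
  proof -
    have "circle_integral p (\<lambda>z. u z + u' z) r \<le> (\<integral>\<^sup>+\<theta>. ennreal (2 powr p) *
        (ennreal (norm (u (of_real r * cis \<theta>)) powr p) * indicator {0..2*pi} \<theta>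
        + ennreal (norm (u' (of_real r * cis \<theta>)) powr p) * indicator {0..2*pi} \<theta>) \<partial>lborel)"
      unfolding circle_integral_def
      by (intro nn_integral_mono)
         (auto simp: indicator_def ennreal_leI powr simp flip: ennreal_plus ennreal_mult)
    also have "\<dots> = ennreal (2 powr p) * (circle_integral p u r + circle_integral p u' r)"
      unfolding circle_integral_def by (subst nn_integral_cmult nn_integral_add; measurable)+
    finally show ?thesis .
  qed
  then have "(SUP r\<in>{0<..<1}. circle_integral p (\<lambda>z. u z + u' z) r)
      \<le> ennreal (2 powr p) * ((SUP r\<in>{0<..<1}. circle_integral p u r) + (SUP r\<in>{0<..<1}. circle_integral p u' r))"
    by (intro SUP_least) (meson SUP_upper add_mono mult_left_mono order_trans zero_le)
  also have "\<dots> < \<infinity>"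
    using fin fin' by (simp add: ennreal_mult_less_top)
  finally show ?thesis
    using rep by (auto simp: bounded_circle_integrals_def)
qed

text \<open>On the circle of radius \<open>r\<close> the power has modulus
  \<open>r ^ k \<le> 1\<close>, so only the constant \<open>\<bar>c\<bar> powr p\<close>
  appears.\<close>

lemma bounded_circle_integrals_scaled:
  assumes p: "0 < p" and v: "bounded_circle_integrals p v"
  shows "bounded_circle_integrals p (\<lambda>z. c *\<^sub>R (bc_hat (cnj z) ^ k * v z))"
proof -
  obtain u where u: "u \<in> representatives v" and fin: "(SUP r\<in>{0<..<1}. circle_integral p u r) < \<infinity>"
    using v by (auto simp: bounded_circle_integrals_def)
  have [measurable]: "u \<in> borel_measurable borel"
    using u by (auto simp: representatives_def)
  let ?u = "\<lambda>z. c *\<^sub>R (bc_hat (cnj z) ^ k * u z)"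
  have "?u \<in> borel_measurable borel"
    by (intro borel_measurable_scaleR borel_measurable_const borel_measurable_bc_hat_power_mult) measurable
  then have rep: "?u \<in> representatives (\<lambda>z. c *\<^sub>R (bc_hat (cnj z) ^ k * v z))"
    using u by (auto simp: representatives_def elim: eventually_mono)
  have [measurable]: "(\<lambda>\<theta>. of_real r * cis \<theta>) \<in> borel_measurable borel" for r
    by (intro borel_measurable_continuous_onI continuous_intros)
  have "circle_integral p ?u r \<le> ennreal (\<bar>c\<bar> powr p) * circle_integral p u r" if r: "r \<in> {0<..<1}" for r
  proof -
    have powr: "norm (?u (of_real r * cis \<theta>)) powr p \<le> \<bar>c\<bar> powr p * norm (u (of_real r * cis \<theta>)) powr p" for \<theta>
    proof -
      have "r ^ k * norm (u (of_real r * cis \<theta>)) \<le> norm (u (of_real r * cis \<theta>))"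
        using r by (intro mult_left_le_one_le) (auto simp: power_le_one)
      then have "norm (?u (of_real r * cis \<theta>)) \<le> \<bar>c\<bar> * norm (u (of_real r * cis \<theta>))"
        using r by (simp add: norm_bc_hat_power_mult norm_mult mult_left_mono)
      with p show ?thesis
        by (simp only: powr_mult[symmetric] abs_ge_zero norm_ge_zero powr_mono2)
    qed
    have "circle_integral p ?u r \<le> (\<integral>\<^sup>+\<theta>. ennreal (\<bar>c\<bar> powr p) *
        (ennreal (norm (u (of_real r * cis \<theta>)) powr p) * indicator {0..2*pi} \<theta>) \<partial>lborel)"
      unfolding circle_integral_def using powr
      by (intro nn_integral_mono) (auto simp: indicator_def ennreal_leI simp flip: ennreal_mult)
    also have "\<dots> = ennreal (\<bar>c\<bar> powr p) * circle_integral p u r"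
      unfolding circle_integral_def by (rule nn_integral_cmult) measurable
    finally show ?thesis .
  qed
  then have "(SUP r\<in>{0<..<1}. circle_integral p ?u r)
      \<le> ennreal (\<bar>c\<bar> powr p) * (SUP r\<in>{0<..<1}. circle_integral p u r)"
    by (intro SUP_least) (meson SUP_upper mult_left_mono order_trans zero_le)
  also have "\<dots> < \<infinity>"
    using fin by (simp add: ennreal_mult_less_top)
  finally show ?thesis
    using rep by (auto simp: bounded_circle_integrals_def)
qed

lemma bounded_circle_integrals_cong_AE:
  assumes "bounded_circle_integrals p v" "AE z in lebesgue. z \<in> unit_disk \<longrightarrow> v z = v' z"
  shows "bounded_circle_integrals p v'"
proof -
  have "representatives v \<subseteq> representatives v'"
    using assms(2) by (auto simp: representatives_def elim: eventually_elim2)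
  with assms(1) show ?thesis by (auto simp: bounded_circle_integrals_def)
qed

lemma bounded_circle_integrals_sum:
  assumes "0 < p" "finite I" "\<And>i. i \<in> I \<Longrightarrow> bounded_circle_integrals p (v i)"
  shows "bounded_circle_integrals p (\<lambda>z. \<Sum>i\<in>I. v i z)"
  using assms(2,3)
proof (induction I rule: finite_induct)
  case empty
  have "(\<lambda>_. 0) \<in> representatives (\<lambda>_. 0)" by (simp add: representatives_def)
  then show ?case
    using \<open>0 < p\<close> by (auto simp: bounded_circle_integrals_def circle_integral_def intro!: bexI[of _ "\<lambda>_. 0"])
qed (simp add: bounded_circle_integrals_add[OF assms(1)])

theorem theorem3p17:
  fixes p c :: real and n :: nat
    and \<mu> w :: "complex \<Rightarrow> bicomplex"
    and wk :: "nat \<Rightarrow> complex \<Rightarrow> bicomplex"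
  assumes "0 < p" and "0 < n"
    and "\<mu> \<in> Wkinf (n - 1)"
    and "0 < c" and "c < 1" and "Wkinf_norm (n - 1) \<mu> \<le> ennreal c"
    and "\<And>k. k < n \<Longrightarrow> solves_beltrami \<mu> (wk k)"
    and "\<And>z. z \<in> unit_disk \<Longrightarrow> w z = (\<Sum>k<n. bc_hat (cnj z) ^ k * wk k z)"
  shows "w \<in> H_Bel_n n p \<mu> \<longleftrightarrow> (\<forall>k<n. wk k \<in> H_Bel p \<mu>)"
proof -
  define a where "a m k = (\<Prod>i<m. real (k - i))" for m k :: nat
  let ?t = "\<lambda>m k z. a m k *\<^sub>R (bc_hat (cnj z) ^ (k - m) * wk k z)"
  have pow: "AE z in lebesgue. z \<in> unit_disk \<longrightarrow> (beltrami_op \<mu> ^^ m) w z = (\<Sum>k<n. ?t m k z)" for m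
    unfolding a_def by (rule beltrami_op_power_bc_hat_sum[OF assms(7,8)])
  \<comment> \<open>The iterated equation holds for \<open>w\<close> by its form, so membership
    reduces to finiteness of each summand.\<close>
  have "w \<in> H_Bel_n n p \<mu> \<longleftrightarrow> (\<forall>m<n. bounded_circle_integrals p ((beltrami_op \<mu> ^^ m) w))"
    using solves_beltrami_iterated_bc_hat_sum[OF assms(7,8)]
    by (simp add: H_Bel_n_def less_top Ball_def flip: circle_sup_less_top_iff)
  also have "\<dots> \<longleftrightarrow> (\<forall>k<n. bounded_circle_integrals p (wk k))"
  proof (intro iffI allI impI)
    fix m assume wk: "\<forall>k<n. bounded_circle_integrals p (wk k)"
    have "bounded_circle_integrals p (\<lambda>z. \<Sum>k<n. ?t m k z)"
      by (rule bounded_circle_integrals_sum[OF assms(1) finite_lessThan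
          bounded_circle_integrals_scaled[OF assms(1)]]) (use wk in auto)
    then show "bounded_circle_integrals p ((beltrami_op \<mu> ^^ m) w)"
    proof (rule bounded_circle_integrals_cong_AE)
      show "AE z in lebesgue. z \<in> unit_disk \<longrightarrow> (\<Sum>k<n. ?t m k z) = (beltrami_op \<mu> ^^ m) w z"
        using pow[of m] by eventually_elim metis
    qed
  next
    fix m
    assume pw: "\<forall>m<n. bounded_circle_integrals p ((beltrami_op \<mu> ^^ m) w)" and "m < n"
    from \<open>m < n\<close> show "bounded_circle_integrals p (wk m)"
    \<comment> \<open>The measure \<open>n - m\<close> turns strong induction into a descent in
      \<open>m\<close>. At \<open>m = n - 1\<close> the sum over larger indices is empty, so no
      separate base case arises.\<close>
    proof (induction "n - m" arbitrary: m rule: less_induct)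
      case less
      have IH: "bounded_circle_integrals p (wk k)" if "k \<in> {m<..<n}" for k
        using that by (intro less.hyps) auto
      \<comment> \<open>Removing the already controlled terms of index above \<open>m\<close> from
        the \<open>m\<close>-th iterate leaves \<open>a m m *\<^sub>R wk m z\<close> a.e. on the
        disk.\<close>
      let ?f = "\<lambda>z. (beltrami_op \<mu> ^^ m) w z + (\<Sum>k\<in>{m<..<n}. (- a m k) *\<^sub>R (bc_hat (cnj z) ^ (k - m) * wk k z))"
      have "bounded_circle_integrals p (\<lambda>z. \<Sum>k\<in>{m<..<n}. (- a m k) *\<^sub>R (bc_hat (cnj z) ^ (k - m) * wk k z))"
        by (rule bounded_circle_integrals_sum[OF assms(1) finite_greaterThanLessThan
            bounded_circle_integrals_scaled[OF assms(1) IH]]) simp_all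
      then have "bounded_circle_integrals p ?f"
        using pw less.prems by (intro bounded_circle_integrals_add[OF assms(1)]) blast+
      \<comment> \<open>Exponent 0 reduces the scaling lemma to multiplication by a real
        constant.\<close>
      from bounded_circle_integrals_scaled[OF assms(1) this, of "1 / a m m" 0]
      have "bounded_circle_integrals p (\<lambda>z. (1 / a m m) *\<^sub>R ?f z)"
        by (simp only: power_0 mult_1)
      then show ?case
      proof (rule bounded_circle_integrals_cong_AE)
        have pos: "a m m \<noteq> 0" by (simp add: a_def)
        have zero: "a m k = 0" if "k < m" for k
          unfolding a_def using that by (intro prod_zero bexI[of _ k]) auto
        have split: "(\<Sum>k<n. ?t m k z) = a m m *\<^sub>R wk m z + (\<Sum>k\<in>{m<..<n}. ?t m k z)" for z
        proof -
          have "(\<Sum>k<n. ?t m k z) = (\<Sum>k\<in>{..<m} \<union> insert m {m<..<n}. ?t m k z)"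
            using less.prems by (intro sum.cong refl) auto
          also have "\<dots> = (\<Sum>k<m. ?t m k z) + (\<Sum>k\<in>insert m {m<..<n}. ?t m k z)"
            by (rule sum.union_disjoint) auto
          also have "(\<Sum>k<m. ?t m k z) = 0"
            by (rule sum.neutral) (simp add: zero)
          finally show ?thesis by simp
        qed
        show "AE z in lebesgue. z \<in> unit_disk \<longrightarrow> (1 / a m m) *\<^sub>R ?f z = wk m z"
          using pow[of m]
        proof eventually_elim
          case (elim z)
          have "?f z = a m m *\<^sub>R wk m z" if "z \<in> unit_disk"
          proof -
            have "(beltrami_op \<mu> ^^ m) w z = a m m *\<^sub>R wk m z + (\<Sum>k\<in>{m<..<n}. ?t m k z)"
              using elim[THEN mp, OF that] split[of z] by (rule trans)
            moreover have "(\<Sum>k\<in>{m<..<n}. (- a m k) *\<^sub>R (bc_hat (cnj z) ^ (k - m) * wk k z))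
                = - (\<Sum>k\<in>{m<..<n}. ?t m k z)"
              by (simp only: scaleR_minus_left sum_negf)
            ultimately show ?thesis by (simp only: add_uminus_conv_diff add_diff_cancel_right')
          qed
          moreover have "(1 / a m m) *\<^sub>R (a m m *\<^sub>R wk m z) = wk m z"
            using pos by simp
          ultimately show ?case by metis
        qed
      qed
    qed
  qed
  \<comment> \<open>Each \<open>wk k\<close> solves the Beltrami equation by hypothesis, which
    leaves only the norm condition of \<open>H_Bel\<close>.\<close>
  also have "\<dots> \<longleftrightarrow> (\<forall>k<n. wk k \<in> H_Bel p \<mu>)"
    using assms(7) by (simp add: H_Bel_def flip: hardy_norm_less_top_iff)
  finally show ?thesis .
qed

end
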